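(* Let $\widetilde{M}$ be the reduced matching equation matrix of a 3-manifold triangulation of size $n$, let $k=\operatorname{rank}\widetilde{M}$, and let $\delta(\widetilde{M})$ be its bounding constant. Let $\beta=\{\beta_1,\dots,\beta_k\}\subseteq\{1,\dots,3n\}$ be any basis, i.e. any set of $k$ indices identifying $k$ linearly independent columns of $\widetilde{M}$, and let $\widetilde{M}_\beta^{-1}$ be the inverse of the $k\times k$ matrix $\widetilde{M}_\beta$ formed from columns $\beta_1,\dots,\beta_k$ of $\widetilde{M}$. Then $\widetilde{M}_\beta^{-1}$ can be expressed in the form $\widetilde{M}_\beta^{-1}=N/\Delta$, where $\Delta$ is an integer with $|\Delta|\le\delta(\widetilde{M})$, and where $N$ is an integer matrix with entries satisfying $|n_{i,j}|\le\delta(\widetilde{M})$ for every $i,j$.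
   Context: **Triangulations.** A 3-manifold triangulation of size $n$ is a collection of $n$ tetrahedra, some or all of whose $4n$ faces are affinely identified in pairs so that the resulting topological space is a 3-manifold (possibly with boundary). Two faces of the same tetrahedron may be identified, and different edges or vertices of the same tetrahedron may become identified. **Matching equations.** Each tetrahedron with vertices $a,b,c,d$ has three quadrilateral types, corresponding to the three splittings $ab|cd$, $ac|bd$, $ad|bc$ of its vertices into two pairs. The coordinates $x_{3i-2},x_{3i-1},x_{3i}$ of $\mathbf{x}\in\mathbb{R}^{3n}$ correspond (in some fixed order) to the three quadrilateral types of the $i$th tetrahedron. For each edge $E$ of the triangulation (i.e. each class of identified tetrahedron edges) not lying in the boundary, fix an orientation of $E$ and a direction of travel around $E$. The tetrahedron corners around $E$ form a cycle; at each corner there is a tetrahedron with an edge $ab$ representing $E$ (oriented from $a$ to $b$), passed through from its face $abc$ to its face $abd$. This corner contributes $x_{ac|bd}-x_{ad|bc}$ (the coordinates being those of that tetrahedron). The matching equation of $E$ says that the sum of the contributions of all corners around $E$ is zero (a tetrahedron contributes once for each of its edges identified with $E$). $M$ is the integer coefficient matrix of these equations, with $3n$ columns and one row for each edge not in the boundary, from which rows have then been deleted until $M$ has full (row) rank. **Reduced matrix.** $\widetilde{M}$ is obtained from $M$ by dividing each non-zero column by the (positive) greatest common divisor of its entries. Thus $\operatorname{rank}\widetilde{M}=\operatorname{rank}M=k$ and $\widetilde{M}$ is a $k\times 3n$ integer matrix. **Bounding constant.** $\delta(\widetilde{M})$ is the product of the $k$ largest Euclidean lengths among the $3n$ columns of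 $\widetilde{M}$ (counted with multiplicity), where the length of column $c$ is $(\sum_i\widetilde{M}_{i,c}^2)^{1/2}$. *)

theory Defs
  imports
    "HOL-Analysis.Analysis"
    "HOL-Library.Sublist"
    "Jordan_Normal_Form.DL_Rank"
begin

text \<open>
  The vertices of every tetrahedron are labelled by the four-element type 4, and a face is named by
  the vertex opposite to it.  \<open>g i f = Some (j, \<sigma>)\<close> means that face \<open>f\<close> of tetrahedron \<open>i\<close> is affinely
  identified with face \<open>\<sigma> f\<close> of tetrahedron \<open>j\<close> by sending each vertex \<open>v \<noteq> f\<close> to \<open>\<sigma> v\<close>;
  \<open>g i f = None\<close> means that the face is not identified with any other face.  The value \<open>\<sigma> f\<close> carries
  no geometric information beyond naming the target face.
\<close>

type_synonym gluing = "nat \<Rightarrow> 4 \<Rightarrow> (nat \<times> (4 \<Rightarrow> 4)) option"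

definition face_pairing :: "nat \<Rightarrow> gluing \<Rightarrow> bool" where
  "face_pairing n g \<longleftrightarrow>
     (\<forall>i f j \<sigma>. g i f = Some (j, \<sigma>) \<longrightarrow>
        i < n \<and> j < n \<and> bij \<sigma> \<and> (j, \<sigma> f) \<noteq> (i, f) \<and> g j (\<sigma> f) = Some (i, inv_into UNIV \<sigma>))"


section \<open>The underlying space of a triangulation\<close>

text \<open>A tetrahedron in barycentric coordinates.  The explicit \<open>vec_nth\<close> avoids the infix dollar
  sign, which also denotes the component selection of \<open>Jordan_Normal_Form.Matrix\<close>.\<close>

definition tetrahedron :: "(real ^ 4) set" where
  "tetrahedron = {x. (\<forall>v. 0 \<le> vec_nth x v) \<and> (\<Sum>v\<in>UNIV. vec_nth x v) = 1}"

text \<open>The affine map of tetrahedra that sends vertex \<open>v\<close> to vertex \<open>\<sigma> v\<close>.\<close>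

definition affine_perm :: "(4 \<Rightarrow> 4) \<Rightarrow> real ^ 4 \<Rightarrow> real ^ 4" where
  "affine_perm \<sigma> x = (\<chi> v. vec_nth x (inv_into UNIV \<sigma> v))"

definition point_gluing :: "gluing \<Rightarrow> ((nat \<times> (real ^ 4)) \<times> (nat \<times> (real ^ 4))) set" where
  "point_gluing g =
     {((i, x), (j, affine_perm \<sigma> x)) | i x j \<sigma>.
        \<exists>f. g i f = Some (j, \<sigma>) \<and> x \<in> tetrahedron \<and> vec_nth x f = 0}"

definition equiv_closure :: "('a \<times> 'a) set \<Rightarrow> ('a \<times> 'a) set" where
  "equiv_closure R = (R \<union> R\<inverse>)\<^sup>*"

lemma equiv_equiv_closure: "equiv UNIV (equiv_closure R)"
  unfolding equiv_closure_def
  by (intro equivI refl_rtrancl trans_rtrancl sym_rtrancl) (auto simp: sym_def)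

definition quotient_topology :: "'a topology \<Rightarrow> ('a \<times> 'a) set \<Rightarrow> 'a set topology" where
  "quotient_topology X R = topology (\<lambda>\<U>. \<U> \<subseteq> topspace X // R \<and> openin X (\<Union>\<U>))"

lemma openin_quotient_topology:
  assumes "equiv UNIV R"
  shows "openin (quotient_topology X R) \<U> \<longleftrightarrow> \<U> \<subseteq> topspace X // R \<and> openin X (\<Union>\<U>)"
proof -
  have Int: "\<Union>(\<U> \<inter> \<V>) = \<Union>\<U> \<inter> \<Union>\<V>"
    if "\<U> \<subseteq> topspace X // R" "\<V> \<subseteq> topspace X // R" for \<U> \<V>
  proof -
    have sub: "topspace X // R \<subseteq> UNIV // R"
      by (auto simp: quotient_def)
    have "A = B" if "x \<in> A" "x \<in> B" "A \<in> \<U>" "B \<in> \<V>" for x A B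
      using quotient_disj[OF assms, of A B] sub that \<open>\<U> \<subseteq> _\<close> \<open>\<V> \<subseteq> _\<close> by blast
    then show ?thesis by blast
  qed
  have "istopology (\<lambda>\<U>. \<U> \<subseteq> topspace X // R \<and> openin X (\<Union>\<U>))"
    unfolding istopology_def
  proof (intro conjI allI impI)
    fix \<U> \<V> assume "\<U> \<subseteq> topspace X // R \<and> openin X (\<Union>\<U>)" "\<V> \<subseteq> topspace X // R \<and> openin X (\<Union>\<V>)"
    then show "\<U> \<inter> \<V> \<subseteq> topspace X // R" "openin X (\<Union>(\<U> \<inter> \<V>))"
      by (auto simp: Int)
  next
    fix \<K> assume *: "\<forall>K\<in>\<K>. K \<subseteq> topspace X // R \<and> openin X (\<Union>K)"
    then show "\<Union>\<K> \<subseteq> topspace X // R" by blast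
    have "\<Union>(\<Union>\<K>) = \<Union>((\<lambda>K. \<Union>K) ` \<K>)" by blast
    moreover have "openin X (\<Union>((\<lambda>K. \<Union>K) ` \<K>))" using * by (intro openin_Union) blast
    ultimately show "openin X (\<Union>(\<Union>\<K>))" by simp
  qed
  then show ?thesis by (simp add: quotient_topology_def)
qed

definition triangulation_space :: "nat \<Rightarrow> gluing \<Rightarrow> (nat \<times> (real ^ 4)) set topology" where
  "triangulation_space n g =
     quotient_topology (sum_topology (\<lambda>i. top_of_set tetrahedron) {..<n})
       (equiv_closure (point_gluing g))"

text \<open>Topological 3-manifolds with (possibly empty) boundary, not necessarily connected.\<close>

definition three_manifold :: "'a topology \<Rightarrow> bool" where
  "three_manifold X \<longleftrightarrow>
     Hausdorff_space X \<and> second_countable X \<and>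
     (\<forall>p\<in>topspace X. \<exists>U V. openin X U \<and> p \<in> U \<and>
        openin (top_of_set {x :: real ^ 3. 0 \<le> vec_nth x 1}) V \<and>
        subtopology X U homeomorphic_space top_of_set V)"

definition manifold_triangulation :: "nat \<Rightarrow> gluing \<Rightarrow> bool" where
  "manifold_triangulation n g \<longleftrightarrow> face_pairing n g \<and> three_manifold (triangulation_space n g)"


section \<open>Edges\<close>

type_synonym tet_edge = "nat \<times> 4 set"

definition tet_edges :: "nat \<Rightarrow> tet_edge set" where
  "tet_edges n = {(i, {a, b}) | i a b. i < n \<and> a \<noteq> b}"

definition edge_gluing :: "gluing \<Rightarrow> (tet_edge \<times> tet_edge) set" where
  "edge_gluing g =
     {((i, {a, b}), (j, {\<sigma> a, \<sigma> b})) | i a b j \<sigma>.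
        \<exists>f. g i f = Some (j, \<sigma>) \<and> a \<noteq> b \<and> f \<noteq> a \<and> f \<noteq> b}"

definition edges :: "nat \<Rightarrow> gluing \<Rightarrow> tet_edge set set" where
  "edges n g = tet_edges n // equiv_closure (edge_gluing g)"

text \<open>The boundary is the union of the faces that are not identified with any other face.\<close>

definition boundary_edge :: "gluing \<Rightarrow> tet_edge set \<Rightarrow> bool" where
  "boundary_edge g E \<longleftrightarrow> (\<exists>(i, e)\<in>E. \<exists>f. f \<notin> e \<and> g i f = None)"

definition internal_edges :: "nat \<Rightarrow> gluing \<Rightarrow> tet_edge set set" where
  "internal_edges n g = {E \<in> edges n g. \<not> boundary_edge g E}"


section \<open>Matching equations\<close>

text \<open>
  A corner \<open>(i, a, b, c, d)\<close> is tetrahedron \<open>i\<close> seen from its edge \<open>ab\<close>, oriented from \<open>a\<close> to \<open>b\<close>,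
  and passed through from face \<open>abc\<close> to face \<open>abd\<close>.  One leaves it through the face \<open>abd\<close>, which is
  opposite \<open>c\<close>; if \<open>\<sigma>\<close> is the gluing of that face, then the next tetrahedron is entered through the
  face on \<open>\<sigma> a\<close>, \<open>\<sigma> b\<close>, \<open>\<sigma> d\<close>, and its remaining vertex is \<open>\<sigma> c\<close>.
\<close>

type_synonym corner = "nat \<times> 4 \<times> 4 \<times> 4 \<times> 4"

definition corners :: "nat \<Rightarrow> corner set" where
  "corners n = {(i, a, b, c, d) | i a b c d. i < n \<and> distinct [a, b, c, d]}"

fun next_corner :: "gluing \<Rightarrow> corner \<Rightarrow> corner option" where
  "next_corner g (i, a, b, c, d) =
     (case g i c of None \<Rightarrow> None | Some (j, \<sigma>) \<Rightarrow> Some (j, \<sigma> a, \<sigma> b, \<sigma> d, \<sigma> c))"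

definition corner_cycle :: "gluing \<Rightarrow> corner \<Rightarrow> corner set" where
  "corner_cycle g x = {y. (x, y) \<in> {(u, v). next_corner g u = Some v}\<^sup>*}"

fun corner_edge :: "gluing \<Rightarrow> corner \<Rightarrow> tet_edge set" where
  "corner_edge g (i, a, b, c, d) = equiv_closure (edge_gluing g) `` {(i, {a, b})}"

definition quad_types :: "4 set set set" where
  "quad_types = {{{a, b}, {c, d}} | a b c d. distinct [a, b, c, d]}"

text \<open>\<open>Q i q\<close> is the position, counted from 0, of the coordinate of quadrilateral type \<open>q\<close> in
  tetrahedron \<open>i\<close>.\<close>

definition quad_order :: "nat \<Rightarrow> (nat \<Rightarrow> 4 set set \<Rightarrow> nat) \<Rightarrow> bool" where
  "quad_order n Q \<longleftrightarrow> (\<forall>i<n. bij_betw (Q i) quad_types {3 * i ..< 3 * i + 3})"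

fun corner_coeff :: "(nat \<Rightarrow> 4 set set \<Rightarrow> nat) \<Rightarrow> corner \<Rightarrow> nat \<Rightarrow> int" where
  "corner_coeff Q (i, a, b, c, d) l =
     (if l = Q i {{a, c}, {b, d}} then 1 else 0) - (if l = Q i {{a, d}, {b, c}} then 1 else 0)"

definition matching_row ::
    "nat \<Rightarrow> gluing \<Rightarrow> (nat \<Rightarrow> 4 set set \<Rightarrow> nat) \<Rightarrow> corner \<Rightarrow> int Matrix.vec" where
  "matching_row n g Q x = Matrix.vec (3 * n) (\<lambda>l. \<Sum>y\<in>corner_cycle g x. corner_coeff Q y l)"

text \<open>The list \<open>xs\<close> enumerates the internal edges, each by one corner around it; the choice of that
  corner fixes the orientation of the edge and the direction of travel around it.\<close>

definition full_matching_matrix ::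
    "nat \<Rightarrow> gluing \<Rightarrow> (nat \<Rightarrow> 4 set set \<Rightarrow> nat) \<Rightarrow> int mat \<Rightarrow> bool" where
  "full_matching_matrix n g Q A \<longleftrightarrow>
     (\<exists>xs. set xs \<subseteq> corners n \<and> distinct (map (corner_edge g) xs) \<and>
        set (map (corner_edge g) xs) = internal_edges n g \<and>
        A = mat_of_rows (3 * n) (map (matching_row n g Q) xs))"

definition int_mat_rank :: "int mat \<Rightarrow> nat" where
  "int_mat_rank A = vec_space.rank (dim_row A) (map_mat real_of_int A)"

text \<open>Only redundant rows are deleted: the rank stays that of the full system of equations.\<close>

definition matching_matrix ::
    "nat \<Rightarrow> gluing \<Rightarrow> (nat \<Rightarrow> 4 set set \<Rightarrow> nat) \<Rightarrow> int mat \<Rightarrow> bool" where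
  "matching_matrix n g Q M \<longleftrightarrow>
     (\<exists>A rs. full_matching_matrix n g Q A \<and> subseq rs (rows A) \<and> M = mat_of_rows (3 * n) rs \<and>
        int_mat_rank M = dim_row M \<and> int_mat_rank M = int_mat_rank A)"


section \<open>Reduced matrix and bounding constant\<close>

text \<open>A zero column has \<open>Gcd\<close> 0 and stays zero, since \<open>0 div 0 = 0\<close>.\<close>

definition reduced_matrix :: "int mat \<Rightarrow> int mat" where
  "reduced_matrix M =
     Matrix.mat (dim_row M) (dim_col M)
       (\<lambda>(i, c). M $$ (i, c) div Gcd {M $$ (r, c) | r. r < dim_row M})"

definition column_length :: "int mat \<Rightarrow> nat \<Rightarrow> real" where
  "column_length A c = sqrt (\<Sum>i<dim_row A. (real_of_int (A $$ (i, c)))\<^sup>2)"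

definition bounding_constant :: "int mat \<Rightarrow> real" where
  "bounding_constant A =
     prod_list (take (int_mat_rank A) (rev (sort (map (column_length A) [0..<dim_col A]))))"

definition column_submatrix :: "int mat \<Rightarrow> nat list \<Rightarrow> real mat" where
  "column_submatrix A \<beta> = mat_of_cols (dim_row A) (map (col (map_mat real_of_int A)) \<beta>)"

text \<open>Distinctness is required because \<open>lin_dep\<close> speaks about the set of columns, which does not
  see repetitions.\<close>

definition column_basis :: "int mat \<Rightarrow> nat list \<Rightarrow> bool" where
  "column_basis A \<beta> \<longleftrightarrow>
     length \<beta> = int_mat_rank A \<and> distinct \<beta> \<and> set \<beta> \<subseteq> {..<dim_col A} \<and>
     distinct (cols (column_submatrix A \<beta>)) \<and>
     \<not> LinearCombinations.module.lin_dep class_ring (module_vec TYPE(real) (dim_row A))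
         (set (cols (column_submatrix A \<beta>)))"

end

theory Submission
  imports Defs
begin

text \<open>
  The inverse of a non-singular integer matrix \<open>B\<close> is its adjugate divided by its determinant, so the
  natural choice is \<open>\<Delta> = det B\<close> and \<open>N = adj B\<close>, where \<open>B\<close> consists of the basis columns.  Everything
  then follows from Hadamard's inequality (\<open>hadamard_inequality\<close>): a determinant is at most the product
  of the Euclidean lengths of its columns.  For \<open>\<Delta>\<close> this product runs over \<open>k\<close> distinct columns of the
  reduced matrix, hence is at most the product of the \<open>k\<close> largest lengths
  (\<open>prod_le_prod_list_largest\<close>).  An entry of \<open>adj B\<close> is, by Cramer's rule, the determinant of \<open>B\<close> with
  one column replaced by a unit vector (\<open>adj_mat_eq_det_replace_col\<close>).  That replacement lengthens no
  column, because a non-zero integer vector has length at least 1; so the same product bounds the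
  entries of \<open>N\<close> (\<open>integer_adjugate_bound\<close>).

  For the basis columns to form a square matrix, the rank of the reduced matrix has to equal its number
  of rows.  The matching equation matrix has full row rank, and dividing its columns by their greatest
  common divisors does not lower the rank (\<open>int_mat_rank_le_reduced_matrix\<close>).
\<close>

section \<open>Hadamard's inequality\<close>

text \<open>
  This is a Householder reflection: if \<open>s\<close> is the length of \<open>v\<close>, then reflecting in the hyperplane
  orthogonal to \<open>w = v - s e\<^sub>0\<close>, if \<open>w\<close> is not zero, exchanges \<open>v\<close> and \<open>s e\<^sub>0\<close>.  The matrix is \<open>I - c w w\<^sup>T\<close> with
  \<open>c = 2 / (w \<bullet> w)\<close>.
\<close>

lemma reflection_matrix_exists:
  fixes v :: "nat \<Rightarrow> real"
  shows "\<exists>H \<in> carrier_mat (Suc n) (Suc n).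
    transpose_mat H * H = 1\<^sub>m (Suc n) \<and>
    (\<forall>i\<in>{1..n}. (\<Sum>l<Suc n. H $$ (i, l) * v l) = 0)"
proof -
  define s where "s = sqrt (\<Sum>l<Suc n. (v l)\<^sup>2)"
  define w where "w l = (if l = 0 then v 0 - s else v l)" for l
  define S where "S = (\<Sum>l<Suc n. (w l)\<^sup>2)"
  define c where "c = 2 / S"
  define H where "H = Matrix.mat (Suc n) (Suc n) (\<lambda>(i, l). of_bool (i = l) - c * w i * w l)"
  \<comment> \<open>Both \<open>2 w \<bullet> v\<close> and \<open>w \<bullet> w\<close> are \<open>2 s\<^sup>2 - 2 s v\<^sub>0\<close>.\<close>
  have wv: "2 * (\<Sum>l<Suc n. w l * v l) = S"
  proof -
    have s2: "s\<^sup>2 = (\<Sum>l<Suc n. (v l)\<^sup>2)"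
      unfolding s_def by (intro real_sqrt_pow2 sum_nonneg) auto
    have "(\<Sum>l<Suc n. w l * v l) = (\<Sum>l<Suc n. (v l)\<^sup>2) - s * v 0"
      by (simp add: w_def lessThan_Suc_eq_insert_0 sum.reindex power2_eq_square algebra_simps)
    moreover have "S = (\<Sum>l<Suc n. (v l)\<^sup>2) - 2 * s * v 0 + s\<^sup>2"
      by (simp add: S_def w_def lessThan_Suc_eq_insert_0 sum.reindex power2_eq_square algebra_simps)
    ultimately show ?thesis using s2 by simp
  qed
  \<comment> \<open>If \<open>v\<close> already is \<open>s e\<^sub>0\<close>, then \<open>S = 0\<close>; division by zero yields \<open>c = 0\<close>, so \<open>H\<close> is the identity
    and the equation still holds.\<close>
  have cc: "c * c * S = 2 * c"
    by (simp add: c_def)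
  have "transpose_mat H * H = 1\<^sub>m (Suc n)"
  proof (rule eq_matI)
    fix i j assume "i < dim_row (1\<^sub>m (Suc n) :: real mat)" "j < dim_col (1\<^sub>m (Suc n) :: real mat)"
    then have ij: "i < Suc n" "j < Suc n" by auto
    have "(transpose_mat H * H) $$ (i, j) = (\<Sum>l<Suc n. H $$ (l, i) * H $$ (l, j))"
      using ij by (auto simp: H_def scalar_prod_def atLeast0LessThan simp del: sum.lessThan_Suc)
    also have "\<dots> = (\<Sum>l<Suc n. (if l = i then of_bool (i = j) else 0) - (if l = i then c * w i * w j else 0)
        - (if l = j then c * w j * w i else 0) + c * c * w i * w j * (w l)\<^sup>2)"
      using ij by (intro sum.cong refl) (auto simp: H_def algebra_simps power2_eq_square)
    also have "\<dots> = of_bool (i = j) - c * w i * w j - c * w j * w i + (c * c * S) * w i * w j"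
      using ij by (simp add: sum.distrib sum_subtractf S_def flip: sum_distrib_left
          del: sum.lessThan_Suc)
    also have "\<dots> = of_bool (i = j)"
      by (simp only: cc) (simp add: algebra_simps)
    finally show "(transpose_mat H * H) $$ (i, j) = 1\<^sub>m (Suc n) $$ (i, j)"
      using ij by simp
  qed (auto simp: H_def)
  moreover have "(\<Sum>l<Suc n. H $$ (i, l) * v l) = 0" if i: "i \<in> {1..n}" for i
  proof -
    have "(\<Sum>l<Suc n. H $$ (i, l) * v l) =
        (\<Sum>l<Suc n. (if l = i then v i else 0) - c * w i * (w l * v l))"
      using i by (intro sum.cong refl) (auto simp: H_def algebra_simps)
    also have "\<dots> = v i - c * w i * (\<Sum>l<Suc n. w l * v l)"
      using i by (simp add: sum_subtractf sum_distrib_left del: sum.lessThan_Suc)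
    also have "\<dots> = v i * (1 - c * (S / 2))"
      using i wv by (simp add: w_def algebra_simps del: sum.lessThan_Suc)
    also have "\<dots> = 0"
    proof (cases "S = 0")
      case True
      then have "w i = 0"
        using i unfolding S_def by (subst (asm) sum_nonneg_eq_0_iff) auto
      then show ?thesis using i by (simp add: w_def)
    qed (simp add: c_def)
    finally show ?thesis .
  qed
  ultimately show ?thesis
    by (intro bexI[of _ H]) (auto simp: H_def simp del: sum.lessThan_Suc)
qed

text \<open>
  Multiplying by an orthogonal matrix changes neither the squared determinant nor the lengths of the
  columns, so the first column may be assumed to be a multiple of \<open>e\<^sub>0\<close>.  Laplace expansion along it
  leaves a smaller determinant, to which the induction hypothesis applies; passing to the minor only
  shortens the remaining columns.
\<close>

theorem hadamard_inequality:
  fixes A :: "real mat"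
  assumes "A \<in> carrier_mat n n"
  shows "(Determinant.det A)\<^sup>2 \<le> (\<Prod>j<n. \<Sum>i<n. (A $$ (i, j))\<^sup>2)"
  using assms
proof (induction n arbitrary: A)
  case 0
  then show ?case by simp
next
  case (Suc n)
  obtain H where H: "H \<in> carrier_mat (Suc n) (Suc n)"
    and HH: "transpose_mat H * H = 1\<^sub>m (Suc n)"
    and H0: "\<And>i. i \<in> {1..n} \<Longrightarrow> (\<Sum>l<Suc n. H $$ (i, l) * A $$ (l, 0)) = 0"
    using reflection_matrix_exists[of n "\<lambda>l. A $$ (l, 0)"] by blast
  define B where "B = H * A"
  have B: "B \<in> carrier_mat (Suc n) (Suc n)"
    using H Suc.prems by (simp add: B_def)
  have "(Determinant.det H)\<^sup>2 = 1"
    using arg_cong[OF HH, of Determinant.det] H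
    by (simp add: Determinant.det_mult[of _ "Suc n"] Determinant.det_transpose[of _ "Suc n"] power2_eq_square)
  then have detB: "(Determinant.det A)\<^sup>2 = (Determinant.det B)\<^sup>2"
    using H Suc.prems by (simp add: B_def Determinant.det_mult[of _ "Suc n"] power_mult_distrib)
  \<comment> \<open>The diagonal entries of the Gram matrix are the squared column lengths.\<close>
  have gram: "transpose_mat B * B = transpose_mat A * A"
  proof -
    have "transpose_mat B * B = transpose_mat A * transpose_mat H * (H * A)"
      using H Suc.prems by (simp add: B_def Matrix.transpose_mult[of _ "Suc n" "Suc n"])
    also have "\<dots> = transpose_mat A * (transpose_mat H * H * A)"
      using H Suc.prems by (simp add: assoc_mult_mat[of _ "Suc n" "Suc n" _ "Suc n" _ "Suc n"])
    finally show ?thesis using Suc.prems by (simp add: HH)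
  qed
  have norm: "(\<Sum>i<Suc n. (B $$ (i, j))\<^sup>2) = (\<Sum>i<Suc n. (A $$ (i, j))\<^sup>2)" if "j < Suc n" for j
  proof -
    have "(\<Sum>i<Suc n. (C $$ (i, j))\<^sup>2) = (transpose_mat C * C) $$ (j, j)"
      if "C \<in> carrier_mat (Suc n) (Suc n)" for C :: "real mat"
      using that \<open>j < Suc n\<close>
      by (auto simp: scalar_prod_def atLeast0LessThan power2_eq_square simp del: sum.lessThan_Suc)
    from this[OF B] this[OF Suc.prems] show ?thesis by (simp only: gram)
  qed
  have B0: "B $$ (i, 0) = 0" if "i \<in> {1..n}" for i
    using H0[OF that] that H Suc.prems
    by (auto simp: B_def scalar_prod_def atLeast0LessThan simp del: sum.lessThan_Suc)
  define C where "C = mat_delete B 0 0"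
  have C: "C \<in> carrier_mat n n" and Cij: "\<And>i j. i < n \<Longrightarrow> j < n \<Longrightarrow> C $$ (i, j) = B $$ (Suc i, Suc j)"
    using B by (auto simp: C_def mat_delete_def)
  have "Determinant.det B = (\<Sum>i<Suc n. B $$ (i, 0) * Determinant.cofactor B i 0)"
    using B by (rule Determinant.laplace_expansion_column) simp
  also have "\<dots> = B $$ (0, 0) * Determinant.det C"
    using B0 by (simp add: lessThan_Suc_eq_insert_0 sum.reindex Determinant.cofactor_def C_def)
  finally have "(Determinant.det A)\<^sup>2 = (B $$ (0, 0))\<^sup>2 * (Determinant.det C)\<^sup>2"
    by (simp add: detB power_mult_distrib)
  also have "\<dots> \<le> (\<Sum>i<Suc n. (B $$ (i, 0))\<^sup>2) * (\<Prod>j<n. \<Sum>i<Suc n. (B $$ (i, Suc j))\<^sup>2)"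
  proof (rule mult_mono)
    show "(B $$ (0, 0))\<^sup>2 \<le> (\<Sum>i<Suc n. (B $$ (i, 0))\<^sup>2)"
      by (rule member_le_sum) auto
    have "(Determinant.det C)\<^sup>2 \<le> (\<Prod>j<n. \<Sum>i<n. (C $$ (i, j))\<^sup>2)"
      using C by (rule Suc.IH)
    also have "\<dots> \<le> (\<Prod>j<n. \<Sum>i<Suc n. (B $$ (i, Suc j))\<^sup>2)"
      by (intro prod_mono conjI sum_nonneg)
        (auto simp: Cij lessThan_Suc_eq_insert_0 sum.reindex)
    finally show "(Determinant.det C)\<^sup>2 \<le> \<dots>" .
  qed (auto intro: sum_nonneg simp del: sum.lessThan_Suc)
  also have "\<dots> = (\<Prod>j<Suc n. \<Sum>i<Suc n. (B $$ (i, j))\<^sup>2)"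
    by (simp add: prod.lessThan_Suc_shift del: sum.lessThan_Suc prod.lessThan_Suc)
  also have "\<dots> = (\<Prod>j<Suc n. \<Sum>i<Suc n. (A $$ (i, j))\<^sup>2)"
    by (intro prod.cong refl norm) simp
  finally show ?case .
qed

section \<open>The adjugate of an integer matrix\<close>

text \<open>
  This form of Cramer's rule makes an entry of the adjugate a determinant of the same size as \<open>A\<close>, so
  that its Hadamard bound can be compared column by column with that of \<open>A\<close>.
\<close>

lemma adj_mat_eq_det_replace_col:
  fixes A :: "'a :: comm_ring_1 mat"
  assumes A: "A \<in> carrier_mat n n" and ij: "i < n" "j < n"
  shows "adj_mat A $$ (i, j) = Determinant.det (replace_col A (unit_vec n j) i)"
proof -
  let ?R = "replace_col A (unit_vec n j) i"
  have R: "?R \<in> carrier_mat n n" using A by (simp add: replace_col_def)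
  have "Determinant.det ?R = (\<Sum>l<n. ?R $$ (l, i) * Determinant.cofactor ?R l i)"
    using R ij by (intro Determinant.laplace_expansion_column)
  also have "\<dots> = (\<Sum>l<n. if l = j then Determinant.cofactor ?R l i else 0)"
    using A ij by (intro sum.cong refl) (auto simp: replace_col_def)
  also have "\<dots> = Determinant.cofactor ?R j i"
    using ij by simp
  also have "\<dots> = Determinant.cofactor A j i"
  proof -
    have "mat_delete ?R j i = mat_delete A j i"
      using A ij by (intro eq_matI) (auto simp: mat_delete_def replace_col_def)
    then show ?thesis by (simp add: Determinant.cofactor_def)
  qed
  finally show ?thesis
    using A ij by (simp add: adj_mat_def)
qed

lemma adj_mat_inverse:
  fixes A :: "'a :: field mat"
  assumes A: "A \<in> carrier_mat n n" and "Determinant.det A \<noteq> 0"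
  shows "inverts_mat A ((1 / Determinant.det A) \<cdot>\<^sub>m adj_mat A)"
    and "inverts_mat ((1 / Determinant.det A) \<cdot>\<^sub>m adj_mat A) A"
  using adj_mat[OF A] A assms(2)
  by (auto simp: inverts_mat_def mult_smult_distrib[OF A] mult_smult_assoc_mat[of _ n n _ n])

text \<open>
  Integrality matters for the second bound: over the reals, a minor can exceed the product of all
  column lengths when some column is shorter than 1.
\<close>

lemma integer_adjugate_bound:
  fixes B :: "int mat"
  assumes B: "B \<in> carrier_mat n n" and det: "Determinant.det B \<noteq> 0"
  defines "P \<equiv> (\<Prod>j<n. sqrt (\<Sum>i<n. (real_of_int (B $$ (i, j)))\<^sup>2))"
  shows "\<bar>real_of_int (Determinant.det B)\<bar> \<le> P"
    and "i < n \<Longrightarrow> j < n \<Longrightarrow> \<bar>real_of_int (adj_mat B $$ (i, j))\<bar> \<le> P"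
proof -
  have had: "\<bar>real_of_int (Determinant.det C)\<bar> \<le> (\<Prod>j<n. sqrt (\<Sum>i<n. (real_of_int (C $$ (i, j)))\<^sup>2))"
    if C: "C \<in> carrier_mat n n" for C :: "int mat"
  proof -
    have "\<bar>real_of_int (Determinant.det C)\<bar>\<^sup>2 \<le> (\<Prod>j<n. \<Sum>i<n. (real_of_int (C $$ (i, j)))\<^sup>2)"
      using hadamard_inequality[of "map_mat real_of_int C" n] C by (simp add: of_int_hom.hom_det)
    also have "\<dots> = (\<Prod>j<n. sqrt (\<Sum>i<n. (real_of_int (C $$ (i, j)))\<^sup>2))\<^sup>2"
      by (simp add: sum_nonneg prod_power_distrib)
    finally show ?thesis
      by (rule power2_le_imp_le) (auto intro!: prod_nonneg sum_nonneg)
  qed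
  show detP: "\<bar>real_of_int (Determinant.det B)\<bar> \<le> P"
    unfolding P_def by (rule had[OF B])
  have ge1: "1 \<le> sqrt (\<Sum>i<n. (real_of_int (B $$ (i, c)))\<^sup>2)" if "c < n" for c
  proof -
    \<comment> \<open>A zero column would make the Hadamard bound on the non-zero determinant vanish.\<close>
    have "P \<noteq> 0" using detP det by auto
    then have "(\<Sum>i<n. (real_of_int (B $$ (i, c)))\<^sup>2) \<noteq> 0"
      using that by (auto simp: P_def)
    then have "(\<Sum>i<n. (B $$ (i, c))\<^sup>2) \<noteq> 0"
      by (metis (mono_tags, lifting) of_int_0 of_int_power of_int_sum sum.cong)
    moreover have "(\<Sum>i<n. (B $$ (i, c))\<^sup>2) \<ge> 0" by (intro sum_nonneg) auto
    ultimately have "1 \<le> (\<Sum>i<n. (B $$ (i, c))\<^sup>2)" by linarith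
    then have "1 \<le> real_of_int (\<Sum>i<n. (B $$ (i, c))\<^sup>2)" by linarith
    then show ?thesis by simp
  qed
  assume ij: "i < n" "j < n"
  let ?R = "replace_col B (unit_vec n j) i"
  have "\<bar>real_of_int (adj_mat B $$ (i, j))\<bar> \<le> (\<Prod>c<n. sqrt (\<Sum>l<n. (real_of_int (?R $$ (l, c)))\<^sup>2))"
    unfolding adj_mat_eq_det_replace_col[OF B ij] by (rule had) (use B in \<open>simp add: replace_col_def\<close>)
  also have "\<dots> \<le> P"
    unfolding P_def
  proof (intro prod_mono conjI)
    fix c assume "c \<in> {..<n}"
    then have c: "c < n" by simp
    show "sqrt (\<Sum>l<n. (real_of_int (?R $$ (l, c)))\<^sup>2) \<le> sqrt (\<Sum>l<n. (real_of_int (B $$ (l, c)))\<^sup>2)"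
    proof (cases "c = i")
      case True
      have "(\<Sum>l<n. (real_of_int (?R $$ (l, c)))\<^sup>2) = (\<Sum>l<n. if l = j then 1 else 0)"
        using B c ij True by (intro sum.cong refl) (auto simp: replace_col_def)
      then show ?thesis using ge1[OF c] ij by simp
    next
      case False
      then show ?thesis using B c by (simp add: replace_col_def)
    qed
  qed (auto intro: sum_nonneg)
  finally show "\<bar>real_of_int (adj_mat B $$ (i, j))\<bar> \<le> P" .
qed

section \<open>Products of the largest entries of a list\<close>

text \<open>
  The maximal entry \<open>y\<close> is exchanged into \<open>xs\<close>: some entry of \<open>xs\<close> can be removed and accounted for
  by \<open>y\<close> such that the rest of \<open>xs\<close> is still contained in the rest of \<open>ys\<close>.
\<close>

lemma prod_list_le_prod_list_take:
  fixes xs ys :: "'a :: linordered_idom list"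
  assumes "sorted_wrt (\<ge>) ys" "mset xs \<subseteq># mset ys" "\<forall>y\<in>set ys. 0 \<le> y"
  shows "prod_list xs \<le> prod_list (take (length xs) ys)"
  using assms
proof (induction ys arbitrary: xs)
  case Nil
  then show ?case by simp
next
  case (Cons y ys)
  show ?case
  proof (cases xs)
    case Nil
    then show ?thesis by simp
  next
    case (Cons x0 xs0)
    \<comment> \<open>If \<open>y\<close> occurs in \<open>xs\<close>, one copy of it has to go, since \<open>ys\<close> may contain no further copy.\<close>
    define x where "x = (if y \<in> set xs then y else x0)"
    have x: "x \<in> set xs" using Cons by (simp add: x_def)
    have set: "set xs \<subseteq> insert y (set ys)"
      using set_mset_mono[OF Cons.prems(2)] by simp
    have "x \<le> y" "0 \<le> x" "0 \<le> y" using set x Cons.prems(1,3) by auto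
    have "mset (remove1 x xs) \<subseteq># mset ys"
    proof (cases "y \<in> set xs")
      case True
      then show ?thesis
        using Cons.prems(2) by (simp add: x_def subset_eq_diff_conv)
    next
      case False
      then have "mset xs \<subseteq># mset ys"
        using Cons.prems(2) by (simp add: subset_mset.le_iff_sup inter_add_right1 subset_mset.inf.absorb_iff1)
      then show ?thesis by (simp add: x_def) (meson diff_subset_eq_self subset_mset.order_trans)
    qed
    then have IH: "prod_list (remove1 x xs) \<le> prod_list (take (length (remove1 x xs)) ys)"
      using Cons.prems by (intro Cons.IH) auto
    have "prod_list xs = x * prod_list (remove1 x xs)"
      using x by (metis mset_remove1 prod_mset_prod_list insert_DiffM in_multiset_in_set prod_mset.add_mset)
    also have "\<dots> \<le> y * prod_list (take (length (remove1 x xs)) ys)"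
      using \<open>x \<le> y\<close> \<open>0 \<le> y\<close> IH
    proof (intro mult_mono)
      show "0 \<le> prod_list (remove1 x xs)"
        using set \<open>0 \<le> y\<close> Cons.prems(3) set_remove1_subset[of x xs]
        by (intro prod_list_nonneg) auto
    qed auto
    also have "\<dots> = prod_list (take (length xs) (y # ys))"
    proof -
      have "length xs = Suc (length (remove1 x xs))"
        using x length_pos_if_in_set[OF x] by (simp add: length_remove1)
      then show ?thesis by (simp only: take_Suc_Cons prod_list.Cons)
    qed
    finally show ?thesis .
  qed
qed

lemma prod_le_prod_list_largest:
  fixes f :: "nat \<Rightarrow> 'a :: linordered_idom"
  assumes "\<And>c. c < m \<Longrightarrow> 0 \<le> f c" and "distinct \<beta>" "set \<beta> \<subseteq> {..<m}"
  shows "prod_list (map f \<beta>) \<le> prod_list (take (length \<beta>) (rev (sort (map f [0..<m]))))"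
proof -
  have "mset \<beta> \<subseteq># mset [0..<m]"
    using assms(2,3) by (subst mset_set_set[symmetric, of \<beta>]) (auto simp: mset_upt intro!: subset_imp_msubset_mset_set)
  then have "mset (map f \<beta>) \<subseteq># mset (rev (sort (map f [0..<m])))"
    using image_mset_subseteq_mono by fastforce
  moreover have "sorted_wrt (\<ge>) (rev (sort (map f [0..<m])))"
    by (simp add: sorted_wrt_rev)
  ultimately show ?thesis
    using prod_list_le_prod_list_take[of "rev (sort (map f [0..<m]))" "map f \<beta>"] assms(1) by auto
qed

section \<open>Rank of the reduced matrix\<close>

lemma dim_reduced_matrix [simp]:
  "dim_row (reduced_matrix M) = dim_row M" "dim_col (reduced_matrix M) = dim_col M"
  by (simp_all add: reduced_matrix_def)


lemma (in vec_space) rank_mono_span: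
  assumes "A \<in> carrier_mat n nc" "B \<in> carrier_mat n nd"
    and cols: "set (cols A) \<subseteq> span (set (cols B))"
  shows "rank A \<le> rank B"
proof -
  have cB: "set (cols B) \<subseteq> carrier_vec n" and cA: "set (cols A) \<subseteq> carrier_vec n"
    using assms(1,2) cols_dim by blast+
  have sub: "subspace class_ring (span (set (cols B))) V" "subspace class_ring (span (set (cols A))) V"
    using cA cB span_is_subspace by auto
  have "span (set (cols A)) \<subseteq> span (set (cols B))"
    using cols cB by (simp add: span_is_subset span_is_submodule)
  then have "subspace class_ring (span (set (cols A))) (span_vs (set (cols B)))"
    using nested_subspaces sub by blast
  moreover have "vectorspace.fin_dim class_ring (span_vs (set (cols B)))"
    "vectorspace.fin_dim class_ring (span_vs (set (cols A)))"
    using assms(1,2) fin_dim_span_cols by auto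
  ultimately show ?thesis
    unfolding rank_def
    using vectorspace.subspace_dim[OF subspace_is_vs[OF sub(1)]] by auto
qed

lemma (in vec_space) rank_le_dim_row:
  assumes "A \<in> carrier_mat n nc"
  shows "rank A \<le> n"
proof -
  have "set (cols A) \<subseteq> span (set (cols (1\<^sub>m n)))"
    using assms cols_dim[of A] span_unit_vecs_is_carrier by (simp add: unit_vecs_def cols_def)
  then have "rank A \<le> rank (1\<^sub>m n)"
    using rank_mono_span[OF assms one_carrier_mat] by blast
  also have "\<dots> \<le> n" by (rule rank_le_nc) simp
  finally show ?thesis .
qed

text \<open>
  Also when it is zero, each column of \<open>M\<close> is a multiple of the corresponding column of the reduced matrix.  Together with
  \<open>rank_le_dim_row\<close>, this inequality forces the reduced matrix to have full row rank whenever \<open>M\<close> has.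
\<close>

lemma int_mat_rank_le_reduced_matrix: "int_mat_rank M \<le> int_mat_rank (reduced_matrix M)"
proof -
  interpret vec_space "TYPE(real)" "dim_row M" .
  let ?A = "map_mat real_of_int M" and ?B = "map_mat real_of_int (reduced_matrix M)"
  have A: "?A \<in> carrier_mat (dim_row M) (dim_col M)" and B: "?B \<in> carrier_mat (dim_row M) (dim_col M)"
    by (rule carrier_matI; simp)+
  have cB: "set (cols ?B) \<subseteq> carrier_vec (dim_row M)" using cols_dim[of ?B] by simp
  have "col ?A c \<in> span (set (cols ?B))" if c: "c < dim_col M" for c
  proof -
    define G where "G = Gcd {M $$ (r, c) | r. r < dim_row M}"
    have "col ?A c = real_of_int G \<cdot>\<^sub>v col ?B c"
    proof (rule eq_vecI)
      fix r assume "r < dim_vec (real_of_int G \<cdot>\<^sub>v col ?B c)"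
      then have r: "r < dim_row M" by simp
      have "G dvd M $$ (r, c)" unfolding G_def using r by (intro Gcd_dvd) auto
      then have "M $$ (r, c) = G * (M $$ (r, c) div G)" by simp
      then have "real_of_int (M $$ (r, c)) = real_of_int G * real_of_int (M $$ (r, c) div G)"
        by (metis of_int_mult)
      then show "vec_index (col ?A c) r = vec_index (real_of_int G \<cdot>\<^sub>v col ?B c) r"
        using r c by (simp add: reduced_matrix_def G_def)
    qed simp
    moreover have "col ?B c \<in> span (set (cols ?B))"
      using c cB by (intro span_mem) (auto simp: cols_def)
    ultimately show ?thesis
      using smult_in_span[OF cB] by simp
  qed
  then have "rank ?A \<le> rank ?B"
    using A B by (intro rank_mono_span) (auto simp: cols_def)
  then show ?thesis by (simp add: int_mat_rank_def)
qed

section \<open>Inverses of basis matrices\<close>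

theorem theorem4p4:
  fixes n k :: nat and g :: gluing and Q :: "nat \<Rightarrow> 4 set set \<Rightarrow> nat"
    and M Mt :: "int mat" and \<beta> :: "nat list"
  assumes "manifold_triangulation n g"
    and "quad_order n Q"
    and "matching_matrix n g Q M"
    and "Mt = reduced_matrix M"
    and "k = int_mat_rank Mt"
    and "column_basis Mt \<beta>"
  shows "\<exists>Minv \<in> carrier_mat k k.
           inverts_mat (column_submatrix Mt \<beta>) Minv \<and> inverts_mat Minv (column_submatrix Mt \<beta>) \<and>
           (\<exists>(\<Delta> :: int) (N :: int mat). \<Delta> \<noteq> 0 \<and> N \<in> carrier_mat k k \<and>
              Minv = (1 / real_of_int \<Delta>) \<cdot>\<^sub>m map_mat real_of_int N \<and>
              \<bar>real_of_int \<Delta>\<bar> \<le> bounding_constant Mt \<and>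
              (\<forall>i<k. \<forall>j<k. \<bar>real_of_int (N $$ (i, j))\<bar> \<le> bounding_constant Mt))"
proof -
  define r where "r = dim_row M"
  have dims: "dim_row Mt = r" by (simp add: assms(4) r_def)
  have "map_mat real_of_int Mt \<in> carrier_mat r (dim_col Mt)"
    by (rule carrier_matI) (simp_all add: dims)
  then have "int_mat_rank Mt \<le> r"
    unfolding int_mat_rank_def dims by (rule vec_space.rank_le_dim_row)
  moreover have "r = int_mat_rank M"
    using assms(3) by (auto simp: matching_matrix_def r_def)
  ultimately have k: "k = r"
    using int_mat_rank_le_reduced_matrix[of M] assms(4,5) by simp
  have \<beta>: "length \<beta> = k" "distinct \<beta>" "set \<beta> \<subseteq> {..<dim_col Mt}"
    and dist: "distinct (cols (column_submatrix Mt \<beta>))"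
    and indep: "\<not> LinearCombinations.module.lin_dep class_ring (module_vec TYPE(real) k)
         (set (cols (column_submatrix Mt \<beta>)))"
    using assms(5,6) dims k by (simp_all add: column_basis_def)
  define B where "B = Matrix.mat k k (\<lambda>(i, j). Mt $$ (i, \<beta> ! j))"
  have B: "B \<in> carrier_mat k k" by (simp add: B_def)
  have \<beta>_lt: "\<beta> ! j < dim_col Mt" if "j < k" for j
    using \<beta> that nth_mem by blast
  have sub: "column_submatrix Mt \<beta> = map_mat real_of_int B"
    using \<beta>_lt \<beta>(1) dims k by (intro eq_matI) (auto simp: column_submatrix_def B_def mat_of_cols_def)
  have RB: "map_mat real_of_int B \<in> carrier_mat k k" using B by simp
  have "vec_space.rank k (map_mat real_of_int B) = k"
    using vec_space.lin_indpt_full_rank[OF RB] dist indep by (simp add: sub)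
  then have "Determinant.det (map_mat real_of_int B) \<noteq> 0"
    using vec_space.det_rank_iff[OF RB] by simp
  then have det: "Determinant.det B \<noteq> 0"
    by (simp add: of_int_hom.hom_det)
  have "(\<Prod>j<k. sqrt (\<Sum>i<k. (real_of_int (B $$ (i, j)))\<^sup>2)) = (\<Prod>j<k. column_length Mt (\<beta> ! j))"
    using dims k by (simp add: B_def column_length_def)
  also have "\<dots> = prod_list (map (column_length Mt) \<beta>)"
    using \<beta>(1) by (simp add: prod.list_conv_set_nth atLeast0LessThan)
  also have "\<dots> \<le> bounding_constant Mt"
    using prod_le_prod_list_largest[of "dim_col Mt" "column_length Mt" \<beta>] \<beta> assms(5)
    by (simp add: bounding_constant_def column_length_def sum_nonneg)
  finally have P: "(\<Prod>j<k. sqrt (\<Sum>i<k. (real_of_int (B $$ (i, j)))\<^sup>2)) \<le> bounding_constant Mt" .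
  \<comment> \<open>The adjugate is polynomial in the entries, hence commutes with the embedding of the integers.\<close>
  have adj: "map_mat real_of_int (adj_mat B) = adj_mat (map_mat real_of_int B)"
    using B by (intro eq_matI)
      (auto simp: adj_mat_def Determinant.cofactor_def mat_delete_def simp flip: of_int_hom.hom_det
        intro!: arg_cong[of _ _ Determinant.det])
  let ?Minv = "(1 / real_of_int (Determinant.det B)) \<cdot>\<^sub>m map_mat real_of_int (adj_mat B)"
  show ?thesis
  proof (intro bexI[of _ ?Minv] conjI exI[of _ "Determinant.det B"] exI[of _ "adj_mat B"] allI impI)
    show "inverts_mat (column_submatrix Mt \<beta>) ?Minv" "inverts_mat ?Minv (column_submatrix Mt \<beta>)"
      using adj_mat_inverse[OF RB] det by (simp_all add: sub adj of_int_hom.hom_det)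
    show "adj_mat B \<in> carrier_mat k k" "?Minv \<in> carrier_mat k k"
      using adj_mat(1)[OF B] by simp_all
    show "\<bar>real_of_int (Determinant.det B)\<bar> \<le> bounding_constant Mt"
      using integer_adjugate_bound(1)[OF B det] P by linarith
    fix i j assume "i < k" "j < k"
    then show "\<bar>real_of_int (adj_mat B $$ (i, j))\<bar> \<le> bounding_constant Mt"
      using integer_adjugate_bound(2)[OF B det] P by fastforce
  qed (use det in simp_all)
qed

end
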